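(* Let $f:\{0,1\}^n\to\{0,1\}$ be a non-constant Boolean function. Then \[ C_1(f) \geq \frac{3}{2}\,\frac{bs_0(f)}{s_0(f)} - \frac{1}{2}. \]
   Context: For $x\in\{0,1\}^n$ and $S\subseteq[n]$, $x^S$ denotes $x$ with all bits in $S$ flipped. The sensitivity $s(f,x)$ is the number of $i\in[n]$ with $f(x)\neq f(x^{\{i\}})$, and $s_0(f)=\max\{s(f,x): f(x)=0\}$. The block sensitivity $bs(f,x)$ is the maximum number $b$ of pairwise disjoint sets $B_1,\dots,B_b\subseteq[n]$ with $f(x^{B_j})\neq f(x)$ for all $j$, and $bs_0(f)=\max\{bs(f,x): f(x)=0\}$. A certificate is a partial assignment $c:S\to\{0,1\}$, $S\subseteq[n]$, such that $f$ is constant on all inputs agreeing with $c$ on $S$; it is a 1-certificate if that constant is 1; its length is $|S|$. $C(f,x)$ is the minimum length of a certificate satisfied by $x$ (i.e. agreeing with $x$ on its domain), and $C_1(f)=\max\{C(f,x): f(x)=1\}$. *)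

theory Defs
  imports Complex_Main
begin

text \<open>Inputs in {0,1}^n are modelled as functions x :: nat => bool with x i = False
  for i >= n (bit i of x is x i, True = 1). A Boolean function is f :: (nat => bool) => bool
  (True = 1); only its values on the cube matter.\<close>

definition cube :: "nat \<Rightarrow> (nat \<Rightarrow> bool) set" where
  "cube n = {x. \<forall>i. n \<le> i \<longrightarrow> \<not> x i}"

definition flip :: "(nat \<Rightarrow> bool) \<Rightarrow> nat set \<Rightarrow> (nat \<Rightarrow> bool)" where
  "flip x S = (\<lambda>i. if i \<in> S then \<not> x i else x i)"

definition sens :: "nat \<Rightarrow> ((nat \<Rightarrow> bool) \<Rightarrow> bool) \<Rightarrow> (nat \<Rightarrow> bool) \<Rightarrow> nat" where
  "sens n f x = card {i \<in> {..<n}. f x \<noteq> f (flip x {i})}"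

definition s0 :: "nat \<Rightarrow> ((nat \<Rightarrow> bool) \<Rightarrow> bool) \<Rightarrow> nat" where
  "s0 n f = Max (sens n f ` {x \<in> cube n. f x = False})"

definition bsens :: "nat \<Rightarrow> ((nat \<Rightarrow> bool) \<Rightarrow> bool) \<Rightarrow> (nat \<Rightarrow> bool) \<Rightarrow> nat" where
  "bsens n f x = Max {b. \<exists>B :: nat \<Rightarrow> nat set.
      (\<forall>j<b. B j \<subseteq> {..<n} \<and> f (flip x (B j)) \<noteq> f x) \<and>
      (\<forall>j<b. \<forall>k<b. j \<noteq> k \<longrightarrow> B j \<inter> B k = {})}"

definition bs0 :: "nat \<Rightarrow> ((nat \<Rightarrow> bool) \<Rightarrow> bool) \<Rightarrow> nat" where
  "bs0 n f = Max (bsens n f ` {x \<in> cube n. f x = False})"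

text \<open>A certificate satisfied by x with domain S is the partial assignment x restricted to S;
  it is a certificate iff f is constant on all inputs agreeing with x on S.\<close>

definition is_cert :: "nat \<Rightarrow> ((nat \<Rightarrow> bool) \<Rightarrow> bool) \<Rightarrow> (nat \<Rightarrow> bool) \<Rightarrow> nat set \<Rightarrow> bool" where
  "is_cert n f x S \<longleftrightarrow> S \<subseteq> {..<n} \<and>
      (\<forall>y\<in>cube n. \<forall>z\<in>cube n. (\<forall>i\<in>S. y i = x i) \<longrightarrow> (\<forall>i\<in>S. z i = x i) \<longrightarrow> f y = f z)"

definition cert :: "nat \<Rightarrow> ((nat \<Rightarrow> bool) \<Rightarrow> bool) \<Rightarrow> (nat \<Rightarrow> bool) \<Rightarrow> nat" where
  "cert n f x = Min (card ` {S. is_cert n f x S})"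

definition C1 :: "nat \<Rightarrow> ((nat \<Rightarrow> bool) \<Rightarrow> bool) \<Rightarrow> nat" where
  "C1 n f = Max (cert n f ` {x \<in> cube n. f x = True})"

end

(* Fix a 0-input x with bs_0(f) disjoint sensitive blocks, shrink the blocks to minimal sets B_i,
   and take a shortest certificate of x with B_i flipped. By minimality its domain contains B_i; let
   Z_i be the rest of the domain, so that |Z_i| <= C_1(f) - 1. The conflict weight of i and j is
   |Z_i \<inter> B_j| + |Z_j \<inter> B_i|.

   (1) If in a set J of blocks every total conflict weight is at most 2, some 0-input has sensitivity
   at least |J|: the conflicts form a multigraph of maximum degree 2, which is oriented along its
   paths and cycles, and a maximal 0-input is chosen with respect to this orientation.

   (2) A large J of this kind exists. In the manner of Motzkin and Straus, minimise the quadratic form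
   with matrix 3I + W (W the conflict weights) on the simplex, and inside the support of the minimiser
   take J locally optimal, so that vertices of J have weight at most 2 to J and all other vertices
   of the support have weight at least 3. Comparing with the uniform distribution gives
   |J| >= 3 k / (2 C_1(f) + 1) for k = bs_0(f). *)

theory Submission
  imports Defs "HOL-Analysis.Function_Topology"
begin

section \<open>Orientations of multigraphs of maximum degree two\<close>

text \<open>The edges in \<open>D\<close> are traversed from \<open>p\<close> to \<open>q\<close>, the others from \<open>q\<close> to \<open>p\<close>. Prescribing that
  no traversal leaves \<open>u\<close> or enters \<open>u'\<close> makes the induction work: peeling off the last edge at \<open>u\<close>
  moves \<open>u\<close> to its other end.\<close>

lemma degree_two_orientation_aux:
  fixes p q :: "'e \<Rightarrow> 'v"
  defines "inc \<equiv> \<lambda>E v. {e \<in> E. p e = v \<or> q e = v}"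
    and "head \<equiv> \<lambda>D e. if e \<in> D then q e else p e"
    and "tail \<equiv> \<lambda>D e. if e \<in> D then p e else q e"
  assumes "finite E" "\<forall>e\<in>E. p e \<noteq> q e" "\<forall>v. card (inc E v) \<le> 2"
    "card (inc E u) \<le> 1" "card (inc E u') \<le> 1" "u = u' \<longrightarrow> inc E u = {}"
  shows "\<exists>D. inj_on (head D) E \<and> inj_on (tail D) E \<and> u \<notin> tail D ` E \<and> u' \<notin> head D ` E"
  using assms(4-)
proof (induction "card E" arbitrary: E u u' rule: less_induct)
  case less
  have fin: "finite (inc F v)" if "F \<subseteq> E" for F v
    using that less.prems(1) by (auto simp: inc_def intro: finite_subset)
  \<comment> \<open>Reinserting \<open>e\<close>, traversed from \<open>x\<close> to
    \<open>y\<close>: this is harmless as long as no other traversal leaves \<open>x\<close> or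
    enters \<open>y\<close>.\<close>
  have ext: "\<exists>D'. inj_on (head D') E \<and> inj_on (tail D') E
      \<and> tail D' ` E = insert x (tail D ` (E - {e})) \<and> head D' ` E = insert y (head D ` (E - {e}))"
    if e: "e \<in> E" and xy: "p e = x \<and> q e = y \<or> p e = y \<and> q e = x"
      and D: "inj_on (head D) (E - {e})" "inj_on (tail D) (E - {e})"
      and x: "x \<notin> tail D ` (E - {e})" and y: "y \<notin> head D ` (E - {e})" for e x y D
  proof -
    define D' where "D' = (if p e = x then insert e D else D - {e})"
    have pq: "p e \<noteq> q e" using e less.prems(2) by auto
    have he: "head D' e = y" "tail D' e = x"
      using xy pq by (auto simp: D'_def head_def tail_def)
    have eq: "head D' a = head D a" "tail D' a = tail D a" if "a \<in> E - {e}" for a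
      using that by (auto simp: D'_def head_def tail_def)
    have E: "E = insert e (E - {e})" using e by auto
    have img: "head D' ` (E - {e}) = head D ` (E - {e})" "tail D' ` (E - {e}) = tail D ` (E - {e})"
      by (intro image_cong refl eq; assumption)+
    have "inj_on (head D') (E - {e})" "inj_on (tail D') (E - {e})"
      using D eq inj_on_cong[of "E - {e}"] by blast+
    hence "inj_on (head D') (insert e (E - {e}))" "inj_on (tail D') (insert e (E - {e}))"
      unfolding inj_on_insert using x y by (simp_all only: img he Diff_idemp simp_thms)
    moreover have "head D' ` insert e (E - {e}) = insert y (head D ` (E - {e}))"
      "tail D' ` insert e (E - {e}) = insert x (tail D ` (E - {e}))"
      by (simp_all only: image_insert img he)
    ultimately show ?thesis using E by metis
  qed
  have ih: "\<exists>D. inj_on (head D) (E - {e}) \<and> inj_on (tail D) (E - {e})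
      \<and> v \<notin> tail D ` (E - {e}) \<and> v' \<notin> head D ` (E - {e})"
    if "e \<in> E" "card (inc (E - {e}) v) \<le> 1" "card (inc (E - {e}) v') \<le> 1"
      "v = v' \<longrightarrow> inc (E - {e}) v = {}" for e v v'
  proof (rule less.hyps)
    show "card (E - {e}) < card E" using that(1) less.prems(1) by (rule card_Diff1_less[rotated])
    show "\<forall>v. card (inc (E - {e}) v) \<le> 2"
    proof
      fix v have "card (inc (E - {e}) v) \<le> card (inc E v)"
        by (rule card_mono[OF fin]) (auto simp: inc_def)
      thus "card (inc (E - {e}) v) \<le> 2" using less.prems(3) order_trans by blast
    qed
  qed (use that less.prems in auto)
  have inc_del: "inc (E - {e}) v = inc E v - {e}" for e v by (auto simp: inc_def)
  have drop: "card (inc (E - {e}) v) = card (inc E v) - 1" if "e \<in> inc E v" for e v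
    using that by (simp add: inc_del)
  have drop1: "card (inc (E - {e}) v) \<le> 1" if "e \<in> inc E v" for e v
    using that drop[OF that] less.prems(3) by (metis diff_le_mono one_add_one add_diff_cancel_left')
  have drop0: "inc (E - {e}) v = {}" if "e \<in> inc E v" "card (inc E v) \<le> 1" for e v
    using that drop[OF that(1)] fin[of "E - {e}" v] by auto
  have mono: "card (inc (E - {e}) v) \<le> card (inc E v)" for e v
    by (rule card_mono[OF fin]) (auto simp: inc_def)
  have noinc: "v \<notin> head D ` F" "v \<notin> tail D ` F" if "inc F v = {}" for v D F
    using that by (auto simp: inc_def head_def tail_def)
  consider (a) e where "e \<in> inc E u" | (b) e where "inc E u = {}" "e \<in> inc E u'"
    | (c) "inc E u = {}" "inc E u' = {}" by blast
  then show ?case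
  proof cases
    \<comment> \<open>The edge at \<open>u\<close> is traversed towards \<open>u\<close>, so in the
      rest nothing may leave its other end \<open>v\<close>. Since \<open>u\<close> has no further
      edge, nothing leaves \<open>u\<close>.\<close>
    case a
    define v where "v = (if p e = u then q e else p e)"
    have e: "e \<in> E" "p e = v \<and> q e = u \<or> p e = u \<and> q e = v" "v \<noteq> u"
      using a less.prems(2) by (auto simp: inc_def v_def)
    have ev: "e \<in> inc E v" using e by (auto simp: inc_def)
    have uu': "u \<noteq> u'" using a less.prems(6) by auto
    obtain D where D: "inj_on (head D) (E - {e})" "inj_on (tail D) (E - {e})"
      "v \<notin> tail D ` (E - {e})" "u' \<notin> head D ` (E - {e})"
      using ih[of e v u'] e(1) drop1[OF ev] le_trans[OF mono less.prems(5)]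
        drop0[OF ev] less.prems(5) by blast
    have u0: "inc (E - {e}) u = {}" using drop0[OF a] less.prems(4) by blast
    obtain D' where "inj_on (head D') E" "inj_on (tail D') E"
      "tail D' ` E = insert v (tail D ` (E - {e}))" "head D' ` E = insert u (head D ` (E - {e}))"
      using ext[OF e(1,2) D(1,2,3) noinc(1)[OF u0]] by blast
    thus ?thesis using D(4) uu' e(3) noinc(2)[OF u0] by (intro exI[of _ D']) auto
  next
    case b
    define v where "v = (if p e = u' then q e else p e)"
    have e: "e \<in> E" "p e = u' \<and> q e = v \<or> p e = v \<and> q e = u'" "v \<noteq> u'"
      using b less.prems(2) by (auto simp: inc_def v_def)
    have ev: "e \<in> inc E v" using e by (auto simp: inc_def)
    have uu': "u \<noteq> u'" "u \<noteq> v" using b ev by auto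
    obtain D where D: "inj_on (head D) (E - {e})" "inj_on (tail D) (E - {e})"
      "u \<notin> tail D ` (E - {e})" "v \<notin> head D ` (E - {e})"
      using ih[of e u v] e(1) drop1[OF ev] le_trans[OF mono less.prems(4)] uu' by blast
    have u0: "inc (E - {e}) u' = {}" using drop0[OF b(2)] less.prems(5) by blast
    obtain D' where "inj_on (head D') E" "inj_on (tail D') E"
      "tail D' ` E = insert u' (tail D ` (E - {e}))" "head D' ` E = insert v (head D ` (E - {e}))"
      using ext[OF e(1,2) D(1,2) noinc(2)[OF u0] D(4)] by blast
    thus ?thesis using D(3) uu' e(3) noinc(1)[OF u0] by (intro exI[of _ D']) auto
  next
    \<comment> \<open>Now any edge may be cut out. Requiring that the rest does not leave
      \<open>p e\<close> and does not enter \<open>q e\<close> keeps room to put \<open>e\<close>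
      back from \<open>p e\<close> to \<open>q e\<close>; this is how cycles are opened.\<close>
    case c
    show ?thesis
    proof (cases "E = {}")
      case False
      then obtain e where e: "e \<in> E" by blast
      have ev: "e \<in> inc E (p e)" "e \<in> inc E (q e)" using e by (auto simp: inc_def)
      obtain D where D: "inj_on (head D) (E - {e})" "inj_on (tail D) (E - {e})"
        "p e \<notin> tail D ` (E - {e})" "q e \<notin> head D ` (E - {e})"
        using ih[of e "p e" "q e"] e drop1[OF ev(1)] drop1[OF ev(2)] less.prems(2) by blast
      obtain D' where "inj_on (head D') E" "inj_on (tail D') E" using ext[OF e _ D] by blast
      thus ?thesis using noinc(2)[OF c(1)] noinc(1)[OF c(2)] by blast
    qed simp
  qed
qed

lemma degree_two_orientation:
  fixes p q :: "'e \<Rightarrow> 'v"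
  assumes "finite E" "\<And>e. e \<in> E \<Longrightarrow> p e \<noteq> q e" "\<And>v. card {e \<in> E. p e = v \<or> q e = v} \<le> 2"
  obtains D where "inj_on (\<lambda>e. if e \<in> D then q e else p e) E"
    "inj_on (\<lambda>e. if e \<in> D then p e else q e) E"
proof -
  \<comment> \<open>\<open>None\<close> is an isolated extra vertex; taking it for both
    \<open>u\<close> and \<open>u'\<close> makes their prescriptions vacuous.\<close>
  have "\<forall>w. card {e \<in> E. Some (p e) = w \<or> Some (q e) = w} \<le> 2"
  proof
    fix w show "card {e \<in> E. Some (p e) = w \<or> Some (q e) = w} \<le> 2"
      using assms(3) by (cases w) auto
  qed
  hence "\<exists>D. inj_on (\<lambda>e. if e \<in> D then Some (q e) else Some (p e)) E
      \<and> inj_on (\<lambda>e. if e \<in> D then Some (p e) else Some (q e)) E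
      \<and> None \<notin> (\<lambda>e. if e \<in> D then Some (p e) else Some (q e)) ` E
      \<and> None \<notin> (\<lambda>e. if e \<in> D then Some (q e) else Some (p e)) ` E"
    by (intro degree_two_orientation_aux) (use assms(1,2) in simp_all)
  then obtain D where "inj_on (\<lambda>e. if e \<in> D then Some (q e) else Some (p e)) E"
    "inj_on (\<lambda>e. if e \<in> D then Some (p e) else Some (q e)) E"
    by blast
  hence "inj_on (\<lambda>e. if e \<in> D then q e else p e) E" "inj_on (\<lambda>e. if e \<in> D then p e else q e) E"
    unfolding inj_on_def by (smt (verit))+
  thus thesis using that by blast
qed

section \<open>A 0-input of high sensitivity from blocks with few conflicts\<close>

text \<open>Here \<open>g X\<close> plays the role of f at the 0-input with \<open>X\<close>
  flipped. A conflict is an element of one block that the certificate of another block forbids. The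
  orientation selects a set \<open>T\<close> of conflict elements that may be flipped, and the other
  conflict elements stay fixed. In a maximal 0-input of this shape each \<open>i\<close> owns a
  sensitive coordinate: an element missing from its block, or the single element violating its
  certificate.\<close>

lemma sensitive_zero:
  fixes g :: "'a set \<Rightarrow> bool" and B Z :: "'i \<Rightarrow> 'a set"
  defines "U \<equiv> \<lambda>J. \<Union>i\<in>J. B i"
  assumes J: "finite J" and finB: "\<And>i. i \<in> J \<Longrightarrow> finite (B i)"
    and disj: "\<And>i j. i \<in> J \<Longrightarrow> j \<in> J \<Longrightarrow> i \<noteq> j \<Longrightarrow> B i \<inter> B j = {}"
    and BZ: "\<And>i. i \<in> J \<Longrightarrow> B i \<inter> Z i = {}"
    and cert: "\<And>i X. i \<in> J \<Longrightarrow> X \<subseteq> U J \<Longrightarrow> B i \<subseteq> X \<Longrightarrow> X \<inter> Z i = {} \<Longrightarrow> g X"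
    and g0: "\<not> g {}"
    and deg: "\<And>i. i \<in> J \<Longrightarrow> (\<Sum>j\<in>J. card (Z i \<inter> B j) + card (Z j \<inter> B i)) \<le> 2"
  shows "\<exists>X \<subseteq> U J. \<not> g X \<and> card J \<le> card {a \<in> U J. g (sym_diff X {a})}"
proof -
  define V where "V = U J"
  have finV: "finite V" using J finB by (auto simp: V_def U_def)
  define blk where "blk b = (SOME i. i \<in> J \<and> b \<in> B i)" for b
  have blk: "blk b \<in> J" "b \<in> B (blk b)" if "b \<in> V" for b
    using that someI_ex[of "\<lambda>i. i \<in> J \<and> b \<in> B i"] by (auto simp: blk_def V_def U_def)
  have blk_eq: "blk b = i" if "i \<in> J" "b \<in> B i" for b i
    using that blk[of b] disj[of "blk b" i] by (auto simp: V_def U_def)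
  have BV: "B i \<subseteq> V" if "i \<in> J" for i using that by (auto simp: V_def U_def)
  \<comment> \<open>The pair \<open>(i, b)\<close> is an edge between \<open>i\<close> and the block
    containing \<open>b\<close>. The two summands in \<open>deg\<close> count the edges at
    \<open>i\<close> by the end at which \<open>i\<close> stands.\<close>
  define E where "E = (SIGMA i:J. Z i \<inter> V)"
  have E_iff: "(i, b) \<in> E \<longleftrightarrow> i \<in> J \<and> b \<in> Z i \<and> b \<in> V" for i b by (auto simp: E_def)
  have finE: "finite E" using J finV by (auto simp: E_def)
  have loop: "fst e \<noteq> blk (snd e)" if "e \<in> E" for e
    using that BZ[of "fst e"] blk[of "snd e"] by (auto simp: E_def)
  have deg2: "card {e \<in> E. fst e = v \<or> blk (snd e) = v} \<le> 2" for v
  proof (cases "v \<in> J")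
    case True
    have "{e \<in> E. fst e = v \<or> blk (snd e) = v}
        = Pair v ` (\<Union>j\<in>J. Z v \<inter> B j) \<union> (SIGMA j:J. Z j \<inter> B v)"
      using True blk blk_eq BV[OF True] by (auto simp: E_def V_def U_def)
    also have "card \<dots> \<le> card (\<Union>j\<in>J. Z v \<inter> B j) + (\<Sum>j\<in>J. card (Z j \<inter> B v))"
      using J finB True by (intro order_trans[OF card_Un_le] add_mono)
        (auto intro!: card_image_le)
    also have "\<dots> \<le> (\<Sum>j\<in>J. card (Z v \<inter> B j)) + (\<Sum>j\<in>J. card (Z j \<inter> B v))"
      by (intro add_mono card_UN_le J order_refl)
    also have "\<dots> \<le> 2" using deg[OF True] by (simp add: sum.distrib)
    finally show ?thesis .
  next
    case False
    hence empty: "{e \<in> E. fst e = v \<or> blk (snd e) = v} = {}" using blk by (auto simp: E_def)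
    show ?thesis unfolding empty by simp
  qed
  have no3: False if "{x, y, z} \<subseteq> {e \<in> E. fst e = v \<or> blk (snd e) = v}" "x \<noteq> y" "x \<noteq> z" "y \<noteq> z"
    for x y z v
  proof -
    have "card {x, y, z} \<le> 2"
      using card_mono[OF _ that(1)] finE deg2[of v] by (auto intro: order_trans)
    thus False using that by simp
  qed
  obtain D where D: "inj_on (\<lambda>e. if e \<in> D then blk (snd e) else fst e) E"
    "inj_on (\<lambda>e. if e \<in> D then fst e else blk (snd e)) E"
    using degree_two_orientation[of E fst "\<lambda>e. blk (snd e)"] finE loop deg2 by blast
  \<comment> \<open>\<open>D\<close> holds the edges traversed from \<open>i\<close> to the block of
    \<open>b\<close>. The next three facts all come from no vertex being entered twice or left
    twice.\<close>
  have D_in: "(e \<in> D) \<noteq> (e' \<in> D)"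
    if "e \<in> E" "e' \<in> E" "e \<noteq> e'" "blk (snd e) = blk (snd e')" for e e'
    using inj_onD[OF D(1), of e e'] inj_onD[OF D(2), of e e'] that
    by (cases "e \<in> D"; cases "e' \<in> D") auto
  have D_out: "\<not> (e \<in> D \<and> e' \<in> D)"
    if "e \<in> E" "e' \<in> E" "e \<noteq> e'" "fst e = fst e'" for e e'
    using inj_onD[OF D(2), of e e'] that by (auto split: if_splits)
  have D_thru: "e \<in> D" if "e \<in> E" "e' \<in> E" "blk (snd e) = fst e'" "e' \<in> D" for e e'
    using inj_onD[OF D(2), of e e'] that loop[of e]
    by (cases "e \<in> D") auto

  \<comment> \<open>An element of \<open>T\<close> violates exactly one certificate, and each certificate is violated by at
    most one element of \<open>T\<close>. A block has at most one element outside \<open>N \<union> T\<close>, and none if its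
    certificate can be violated by \<open>T\<close>.\<close>
  define T where "T = {b. (\<exists>i. (i, b) \<in> E \<inter> D) \<and> (\<forall>i j. (i, b) \<in> E \<longrightarrow> (j, b) \<in> E \<longrightarrow> i = j)}"
  define R where "R = snd ` E"
  define N where "N = V - R"
  have TR: "T \<subseteq> R"
  proof
    fix b assume "b \<in> T"
    then obtain i where "(i, b) \<in> E" unfolding T_def by blast
    thus "b \<in> R" unfolding R_def by force
  qed
  have RV: "R \<subseteq> V" by (auto simp: R_def E_def)
  have T_D: "(i, b) \<in> D" if "b \<in> T" "(i, b) \<in> E" for i b
    using that unfolding T_def by blast
  have T_uniq: "i = j" if "b \<in> T" "(i, b) \<in> E" "(j, b) \<in> E" for i j b
    using that unfolding T_def by blast
  have T_E: "(i, b) \<in> E" if "b \<in> T" "b \<in> Z i" "i \<in> J" for b i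
    using that TR RV by (auto simp: E_iff)
  have T_out: "b = b'" if "b \<in> T" "b' \<in> T" "b \<in> Z i" "b' \<in> Z i" "i \<in> J" for b b' i
    using D_out[of "(i, b)" "(i, b')"] T_D[of b i] T_D[of b' i] T_E[of b i] T_E[of b' i] that
    by auto
  have shared: False
    if asm: "m \<in> (R - T) \<inter> B w" "w \<in> J" "(j, m) \<in> E" "(j, m) \<in> D" "e \<in> E" "snd e \<noteq> m"
      "fst e = w \<or> blk (snd e) = w" for w e j m
  proof -
    \<comment> \<open>As \<open>(j, m)\<close> lies in \<open>D\<close>, only a second edge at
      \<open>m\<close> can keep \<open>m\<close> out of \<open>T\<close>. Together with
      \<open>e\<close> this would give three edges at \<open>w\<close>.\<close>
    obtain j1 j2 where "(j1, m) \<in> E" "(j2, m) \<in> E" "j1 \<noteq> j2"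
      using asm(1,3,4) unfolding T_def by blast
    then obtain j' where j': "(j', m) \<in> E" "j' \<noteq> j" by metis
    have bm: "blk m = w" using asm(1,2) blk_eq by blast
    show False
    proof (rule no3[of "(j, m)" "(j', m)" e w])
      show "{(j, m), (j', m), e} \<subseteq> {e \<in> E. fst e = w \<or> blk (snd e) = w}"
        using asm(3,5,7) j' bm by simp
    qed (use asm(6) j' in auto)
  qed
  have T_miss1: "m = m'" if asm: "w \<in> J" "m \<in> (R - T) \<inter> B w" "m' \<in> (R - T) \<inter> B w" for w m m'
  proof (rule ccontr)
    assume ne: "m \<noteq> m'"
    obtain j j' where j: "(j, m) \<in> E" "(j', m') \<in> E" using asm by (auto simp: R_def)
    have bm: "blk m = w" "blk m' = w" using asm blk_eq by blast+
    have "((j, m) \<in> D) \<noteq> ((j', m') \<in> D)" using D_in[OF j] ne bm by simp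
    thus False
      using shared[OF asm(2,1) j(1) _ j(2)] shared[OF asm(3,1) j(2) _ j(1)] ne bm by auto
  qed
  have T_miss2: False if asm: "w \<in> J" "m \<in> (R - T) \<inter> B w" "t \<in> Z w \<inter> T" for w m t
  proof -
    obtain j where j: "(j, m) \<in> E" using asm by (auto simp: R_def)
    have bm: "blk m = w" using asm blk_eq by blast
    have e: "(w, t) \<in> E" using T_E asm by blast
    \<comment> \<open>The edge \<open>(w, t)\<close> leaves \<open>w\<close>, so the edge through
      \<open>m\<close> cannot leave \<open>w\<close> as well and must enter it.\<close>
    have "(j, m) \<in> D" using D_thru[OF j e] T_D[OF _ e] asm(3) bm by simp
    moreover have "t \<noteq> m" using asm by blast
    ultimately show False using shared[OF asm(2,1) j _ e] by simp
  qed

  \<comment> \<open>Elements of \<open>T\<close> may only be added once the conflict-free part of their block is full, and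
    \<open>\<mu>\<close> compares \<open>card (X \<inter> N)\<close> and \<open>card (X \<inter> T)\<close> lexicographically.\<close>
  define dom where "dom X \<longleftrightarrow> X \<subseteq> N \<union> T \<and> (\<forall>b\<in>X \<inter> T. B (blk b) \<inter> N \<subseteq> X)" for X
  define \<mu> where "\<mu> X = card (X \<inter> N) * (card V + 1) + card (X \<inter> T)" for X
  have "dom X \<and> \<not> g X \<Longrightarrow> \<mu> X < (card V + 1) * (card V + 1)" for X
  proof -
    have "card (X \<inter> N) \<le> card V" "card (X \<inter> T) \<le> card V"
      using TR RV by (auto intro!: card_mono finV simp: N_def)
    hence "\<mu> X \<le> card V * (card V + 1) + card V" unfolding \<mu>_def by (intro add_mono mult_right_mono) auto
    thus ?thesis by simp
  qed
  moreover have "dom {} \<and> \<not> g {}" using g0 by (auto simp: dom_def)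
  ultimately obtain X where X: "dom X" "\<not> g X" and X_max: "\<And>Y. dom Y \<Longrightarrow> \<not> g Y \<Longrightarrow> \<mu> Y \<le> \<mu> X"
    using ex_has_greatest_nat[of "\<lambda>X. dom X \<and> \<not> g X" "{}" \<mu> "(card V + 1) * (card V + 1)"]
    by (meson less_imp_le)
  have XNT: "X \<subseteq> N \<union> T" using X by (simp add: dom_def)
  have XV: "X \<subseteq> V" using XNT TR RV by (auto simp: N_def)
  have NT: "N \<inter> T = {}" using TR by (auto simp: N_def)
  have finX: "finite X" using XV finV finite_subset by blast
  have gN: "g (insert a X)" if "a \<in> N" "a \<notin> X" for a
  proof (rule ccontr)
    assume "\<not> g (insert a X)"
    moreover have "dom (insert a X)" using X(1) that NT by (auto simp: dom_def)
    ultimately have le: "\<mu> (insert a X) \<le> \<mu> X" by (rule X_max[rotated])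
    have "insert a X \<inter> N = insert a (X \<inter> N)" "insert a X \<inter> T = X \<inter> T" using that NT by auto
    hence "\<mu> (insert a X) = \<mu> X + card V + 1" using that finX by (simp add: \<mu>_def)
    thus False using le by simp
  qed
  have gT: "g (insert t X)" if "t \<in> T" "t \<notin> X" "B (blk t) \<inter> N \<subseteq> X" for t
  proof (rule ccontr)
    assume "\<not> g (insert t X)"
    moreover have "dom (insert t X)" using X(1) that NT by (auto simp: dom_def)
    ultimately have le: "\<mu> (insert t X) \<le> \<mu> X" by (rule X_max[rotated])
    have "insert t X \<inter> T = insert t (X \<inter> T)" "insert t X \<inter> N = X \<inter> N" using that NT by auto
    hence "\<mu> (insert t X) = \<mu> X + 1" using that finX by (simp add: \<mu>_def)
    thus False using le by simp
  qed
  \<comment> \<open>If the usable part of the block is not full, maximality makes some addition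
    sensitive, conflict-free elements being tried first. If it is full and no certificate element is
    flipped, exactly one element of the block is missing and adding it completes the certificate.
    Otherwise the block is full and removing the only violating element restores the
    certificate.\<close>
  have coord: "\<exists>a. (a \<in> B i - X \<and> g (insert a X)) \<or> (a \<in> X \<inter> T \<inter> Z i \<and> g (X - {a}))"
    if i: "i \<in> J" for i
  proof (cases "B i \<inter> (N \<union> T) \<subseteq> X")
    case False
    then obtain a where a: "a \<in> B i" "a \<notin> X" "a \<in> N \<or> (a \<in> T \<and> B i \<inter> N \<subseteq> X)" by auto
    thus ?thesis using gN[of a] gT[of a] blk_eq[OF i a(1)] by blast
  next
    case full: True
    have miss: "m \<in> (R - T) \<inter> B i" if "m \<in> B i - X" for m
      using that full BV[OF i] by (auto simp: N_def)
    have ZX: "X \<inter> Z i \<subseteq> T" 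
      using XNT XV i by (force simp: N_def R_def E_def)
    show ?thesis
    proof (cases "X \<inter> Z i = {}")
      case True
      have "\<not> B i \<subseteq> X" using cert[OF i] True X(2) XV by (auto simp: V_def)
      then obtain m where m: "m \<in> B i - X" by blast
      have "B i \<subseteq> insert m X" using T_miss1[OF i miss[OF m] miss] by blast
      moreover have "insert m X \<inter> Z i = {}" using True m BZ[OF i] by auto
      moreover have "insert m X \<subseteq> U J" using m BV[OF i] XV by (auto simp: V_def)
      ultimately have "g (insert m X)" using cert[OF i] by blast
      thus ?thesis using m by blast
    next
      case False
      then obtain t where t: "t \<in> X" "t \<in> Z i" "t \<in> T" using ZX by blast
      have "B i \<subseteq> X"
      proof
        fix m assume "m \<in> B i"
        thus "m \<in> X" using T_miss2[OF i miss, of m t] t by blast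
      qed
      hence "B i \<subseteq> X - {t}" using BZ[OF i] t by blast
      moreover have "(X - {t}) \<inter> Z i = {}" using T_out[OF t(3) _ t(2) _ i] ZX by blast
      ultimately have "g (X - {t})" using cert[OF i, of "X - {t}"] XV by (auto simp: V_def)
      thus ?thesis using t by blast
    qed
  qed
  then obtain s where s: "\<And>i. i \<in> J \<Longrightarrow>
      (s i \<in> B i - X \<and> g (insert (s i) X)) \<or> (s i \<in> X \<inter> T \<inter> Z i \<and> g (X - {s i}))"
    by metis
  \<comment> \<open>A coordinate in \<open>X\<close> lies in \<open>T\<close> and hence belongs to
    \<open>Z i\<close> for only one \<open>i\<close> in \<open>J\<close>; a coordinate outside
    \<open>X\<close> determines its block.\<close>
  have "inj_on s J"
  proof (rule inj_onI)
    fix i j assume ij: "i \<in> J" "j \<in> J" "s i = s j"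
    show "i = j"
    proof (cases "s i \<in> X")
      case True
      hence "s i \<in> X \<inter> T \<inter> Z i" "s i \<in> Z j" using s[of i] s[of j] ij by auto
      thus ?thesis using T_uniq[of "s i" i j] ij XV by (auto simp: E_iff)
    next
      case False
      hence "s i \<in> B i \<inter> B j" using s[of i] s[of j] ij by auto
      thus ?thesis using disj ij by blast
    qed
  qed
  moreover have "s ` J \<subseteq> {a \<in> V. g (sym_diff X {a})}"
  proof safe
    fix i assume i: "i \<in> J"
    show "s i \<in> V" using s[OF i] BV[OF i] XV by blast
    show "g (sym_diff X {s i})" using s[OF i]
    proof (elim disjE conjE)
      assume "s i \<in> B i - X" "g (insert (s i) X)"
      moreover from this have "sym_diff X {s i} = insert (s i) X" by auto
      ultimately show ?thesis by simp
    next
      assume "s i \<in> X \<inter> T \<inter> Z i" "g (X - {s i})"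
      moreover from this have "sym_diff X {s i} = X - {s i}" by auto
      ultimately show ?thesis by simp
    qed
  qed
  ultimately have "card J \<le> card {a \<in> V. g (sym_diff X {a})}"
    using card_inj_on_le[of s J] finV by simp
  thus ?thesis using X(2) XV by (auto simp: V_def)
qed

section \<open>Quadratic forms on the simplex and sparse subsets of a weighted graph\<close>

text \<open>Points vanish off \<open>I\<close>, so the simplex is a closed slice of a product of
  unit intervals and singletons, which is compact by Tychonoff.\<close>

lemma compact_simplex:
  fixes I :: "'i set"
  assumes "finite I"
  shows "compact {p :: 'i \<Rightarrow> real. (\<forall>i. 0 \<le> p i) \<and> (\<forall>i. i \<notin> I \<longrightarrow> p i = 0) \<and> sum p I = 1}"
    (is "compact ?S")
proof -
  define K where "K = (\<lambda>i. if i \<in> I then {0..1} else {0::real})"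
  have K: "compact (Pi\<^sub>E UNIV K)"
    using compactin_PiE[of "\<lambda>i. euclidean" UNIV K]
    by (auto simp: K_def euclidean_product_topology)
  have cont: "continuous_on UNIV (\<lambda>p :: 'i \<Rightarrow> real. sum p I)"
    by (intro continuous_on_sum continuous_on_product_coordinates)
  have "closed {p :: 'i \<Rightarrow> real. sum p I = 1}"
    by (rule closed_Collect_eq[OF cont continuous_on_const])
  moreover have "?S = Pi\<^sub>E UNIV K \<inter> {p. sum p I = 1}"
  proof (intro equalityI subsetI)
    fix p assume p: "p \<in> ?S"
    hence "p i \<le> 1" if "i \<in> I" for i
      using member_le_sum[of i I p] assms that by auto
    thus "p \<in> Pi\<^sub>E UNIV K \<inter> {p. sum p I = 1}" using p by (auto simp: K_def PiE_iff)
  next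
    fix p assume p: "p \<in> Pi\<^sub>E UNIV K \<inter> {p. sum p I = 1}"
    have "0 \<le> p i \<and> (i \<notin> I \<longrightarrow> p i = 0)" for i
    proof -
      have "p i \<in> K i" using p by auto
      thus ?thesis by (auto simp: K_def split: if_splits)
    qed
    thus "p \<in> ?S" using p by auto
  qed
  ultimately show ?thesis using compact_Int_closed[OF K] by simp
qed

text \<open>First-order optimality of a minimiser \<open>p\<close>: at a vertex of its support the
  gradient cannot exceed the average, since moving mass away from that vertex would lower the form.
  The right-hand side is the value of the form at the uniform distribution, an upper bound for the
  minimum.\<close>

lemma simplex_critical_point:
  fixes M :: "'i \<Rightarrow> 'i \<Rightarrow> real"
  assumes I: "finite I" "I \<noteq> {}" and sym: "\<And>i j. i \<in> I \<Longrightarrow> j \<in> I \<Longrightarrow> M i j = M j i"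
  obtains p where "\<And>i. i \<in> I \<Longrightarrow> 0 \<le> p i" "sum p I = 1"
    "\<And>j. j \<in> I \<Longrightarrow> p j > 0 \<Longrightarrow>
      (\<Sum>i\<in>I. M j i * p i) \<le> (\<Sum>i\<in>I. \<Sum>j\<in>I. M i j) / (real (card I))\<^sup>2"
proof -
  define S where "S = {p :: 'i \<Rightarrow> real. (\<forall>i. 0 \<le> p i) \<and> (\<forall>i. i \<notin> I \<longrightarrow> p i = 0) \<and> sum p I = 1}"
  define Q where "Q p = (\<Sum>i\<in>I. p i * (\<Sum>j\<in>I. M i j * p j))" for p
  have card0: "real (card I) > 0" using I by (simp add: card_gt_0_iff)
  define u where "u i = (if i \<in> I then 1 / real (card I) else 0)" for i
  have u: "u \<in> S" using card0 I by (auto simp: S_def u_def)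
  have "continuous_on S Q" unfolding Q_def
    by (intro continuous_intros continuous_on_subset[OF continuous_on_product_coordinates]) auto
  then obtain p where p: "p \<in> S" and p_min: "\<And>y. y \<in> S \<Longrightarrow> Q p \<le> Q y"
    using continuous_attains_inf[of S Q] compact_simplex[OF I(1)] u unfolding S_def by blast
  have psum: "sum p I = 1" and p0: "\<And>i. 0 \<le> p i" using p by (auto simp: S_def)
  have Qu: "Q u = (\<Sum>i\<in>I. \<Sum>j\<in>I. M i j) / (real (card I))\<^sup>2"
    by (simp add: Q_def u_def sum_distrib_left sum_divide_distrib power2_eq_square cong: sum.cong)
  have crit: "(\<Sum>i\<in>I. M j i * p i) \<le> Q p" if j: "j \<in> I" "p j > 0" for j
  proof (rule ccontr)
    define r where "r = (\<Sum>i\<in>I. M j i * p i)"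
    \<comment> \<open>This is the form evaluated at the direction from the vertex \<open>j\<close>
      to \<open>p\<close>, the coefficient of \<open>\<epsilon>\<^sup>2\<close> in
      \<open>Q y\<close> below.\<close>
    define c where "c = Q p - 2 * r + M j j"
    assume "\<not> ?thesis"
    hence gap: "r - Q p > 0" by (simp add: r_def)
    \<comment> \<open>The first bound keeps coordinate \<open>j\<close> nonnegative, the second
      keeps the quadratic term below the linear gain; adding 1 avoids a zero denominator.\<close>
    define \<epsilon> where "\<epsilon> = min (p j) ((r - Q p) / (\<bar>c\<bar> + 1))"
    have c1: "\<bar>c\<bar> + 1 > 0" by linarith
    have \<epsilon>: "\<epsilon> > 0" "\<epsilon> \<le> p j" using gap j c1 by (auto simp: \<epsilon>_def)
    have "\<epsilon> \<le> (r - Q p) / (\<bar>c\<bar> + 1)" by (simp add: \<epsilon>_def)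
    hence \<epsilon>c: "\<epsilon> * (\<bar>c\<bar> + 1) \<le> r - Q p" using c1 by (simp add: pos_le_divide_eq)
    \<comment> \<open>Moving from \<open>p\<close> away from the vertex \<open>j\<close> of the simplex decreases \<open>Q\<close>.\<close>
    define y where "y i = (1 + \<epsilon>) * p i - (if i = j then \<epsilon> else 0)" for i
    have "y i \<ge> 0" for i
    proof -
      have "0 \<le> \<epsilon> * p i" using \<epsilon> p0[of i] by simp
      moreover have "(if i = j then \<epsilon> else 0) \<le> p i" using \<epsilon> p0[of i] by auto
      ultimately show ?thesis unfolding y_def distrib_right by linarith
    qed
    moreover have "sum y I = 1"
      using j I psum by (simp add: y_def sum_subtractf sum_distrib_left[symmetric])
    ultimately have "y \<in> S" using p j by (auto simp: S_def y_def)
    hence "Q p \<le> Q y" by (rule p_min)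
    have My: "(\<Sum>l\<in>I. M i l * y l) = (1 + \<epsilon>) * (\<Sum>l\<in>I. M i l * p l) - \<epsilon> * M i j" for i
    proof -
      have "M i l * y l = (1 + \<epsilon>) * (M i l * p l) - (if l = j then \<epsilon> * M i j else 0)" for l
        by (simp add: y_def algebra_simps)
      thus ?thesis using j I by (simp add: sum_subtractf sum_distrib_left[symmetric])
    qed
    have "Q y = (\<Sum>i\<in>I. (1 + \<epsilon>)\<^sup>2 * (p i * (\<Sum>l\<in>I. M i l * p l)) - \<epsilon> * (1 + \<epsilon>) * (M j i * p i)
        - (if i = j then \<epsilon> * (1 + \<epsilon>) * r - \<epsilon>\<^sup>2 * M j j else 0))"
      unfolding Q_def
    proof (intro sum.cong refl)
      fix i assume i: "i \<in> I"
      have Mij: "M i j = M j i" by (rule sym[OF i j(1)])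
      show "y i * (\<Sum>l\<in>I. M i l * y l) = (1 + \<epsilon>)\<^sup>2 * (p i * (\<Sum>l\<in>I. M i l * p l))
        - \<epsilon> * (1 + \<epsilon>) * (M j i * p i) - (if i = j then \<epsilon> * (1 + \<epsilon>) * r - \<epsilon>\<^sup>2 * M j j else 0)"
        unfolding My Mij by (auto simp: y_def r_def power2_eq_square algebra_simps)
    qed
    also have "\<dots> = (1 + \<epsilon>)\<^sup>2 * Q p - \<epsilon> * (1 + \<epsilon>) * r - (\<epsilon> * (1 + \<epsilon>) * r - \<epsilon>\<^sup>2 * M j j)"
      using j I by (simp add: sum_subtractf sum_distrib_left[symmetric] Q_def r_def)
    also have "\<dots> = Q p + \<epsilon> * (\<epsilon> * c - 2 * (r - Q p))"
      by (simp add: c_def power2_eq_square algebra_simps)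
    finally have "\<epsilon> * (\<epsilon> * c - 2 * (r - Q p)) \<ge> 0" using \<open>Q p \<le> Q y\<close> by simp
    hence "2 * (r - Q p) \<le> \<epsilon> * c" using \<epsilon>(1) by (simp add: zero_le_mult_iff)
    also have "\<epsilon> * c \<le> \<epsilon> * (\<bar>c\<bar> + 1)" using \<epsilon>(1) by (intro mult_left_mono) auto
    also note \<epsilon>c
    finally show False using gap by simp
  qed
  show thesis
  proof (rule that)
    show "sum p I = 1" by (rule psum)
  next
    fix j assume "j \<in> I" "p j > 0"
    thus "(\<Sum>i\<in>I. M j i * p i) \<le> (\<Sum>i\<in>I. \<Sum>j\<in>I. M i j) / (real (card I))\<^sup>2"
      using crit p_min[OF u] Qu by fastforce
  qed (use p0 in auto)
qed

text \<open>For \<open>i\<close> in the support of the critical point, the entries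
  \<open>M j i\<close> with \<open>j\<close> in \<open>J\<close> sum to at least 3: by the diagonal
  if \<open>i\<close> is in \<open>J\<close>, by minimality of \<open>J\<close> otherwise. Averaging
  over \<open>p\<close> and using criticality at each \<open>j\<close> in \<open>J\<close> gives
  \<open>3 \<le> card J * \<Lambda>\<close>.\<close>

lemma sparse_subset:
  fixes w :: "'i \<Rightarrow> 'i \<Rightarrow> nat"
  assumes I: "finite I" "I \<noteq> {}" and sym: "\<And>i j. w i j = w j i" and irrefl: "\<And>i. i \<in> I \<Longrightarrow> w i i = 0"
  obtains J where "J \<subseteq> I" "\<And>j. j \<in> J \<Longrightarrow> (\<Sum>l\<in>J. w j l) \<le> 2"
    "3 * (card I)\<^sup>2 \<le> card J * (3 * card I + (\<Sum>i\<in>I. \<Sum>j\<in>I. w i j))"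
proof -
  define M where "M i j = real (w i j) + (if i = j then 3 else 0)" for i j
  define \<Lambda> where "\<Lambda> = (\<Sum>i\<in>I. \<Sum>j\<in>I. M i j) / (real (card I))\<^sup>2"
  have Msym: "M i j = M j i" for i j using sym[of i j] by (auto simp: M_def)
  obtain p where p0: "\<And>i. i \<in> I \<Longrightarrow> 0 \<le> p i" and psum: "sum p I = 1"
    and crit: "\<And>j. j \<in> I \<Longrightarrow> p j > 0 \<Longrightarrow> (\<Sum>i\<in>I. M j i * p i) \<le> \<Lambda>"
    using simplex_critical_point[of I M] I Msym unfolding \<Lambda>_def by blast
  define P where "P = {i \<in> I. p i > 0}"
  have finP: "finite P" using I by (simp add: P_def)
  \<comment> \<open>Each pair is counted twice, so the threshold is 5/2; by integrality this separates
    degree at most 2 inside \<open>J\<close> from degree at least 3 outside.\<close>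
  define \<Phi> where "\<Phi> J = (\<Sum>i\<in>J. \<Sum>j\<in>J. int (w i j)) - 5 * int (card J)" for J
  obtain J where JP: "J \<subseteq> P" and J_min: "\<And>K. K \<subseteq> P \<Longrightarrow> \<Phi> J \<le> \<Phi> K"
    using ex_is_arg_min_if_finite[of "Pow P" \<Phi>] finP by (auto simp: is_arg_min_linorder)
  have finJ: "finite J" using JP finP finite_subset by blast
  have JI: "J \<subseteq> I" using JP by (auto simp: P_def)
  have ins: "\<Phi> (insert i K) = \<Phi> K + 2 * (\<Sum>l\<in>K. int (w i l)) - 5"
    if "i \<in> I" "i \<notin> K" "finite K" for i K
  proof -
    have "(\<Sum>l\<in>K. int (w l i)) = (\<Sum>l\<in>K. int (w i l))" using sym by simp
    thus ?thesis using that irrefl by (simp add: \<Phi>_def sum.distrib)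
  qed
  have inside: "(\<Sum>l\<in>J. w j l) \<le> 2" if j: "j \<in> J" for j
  proof -
    have "\<Phi> J = \<Phi> (J - {j}) + 2 * (\<Sum>l\<in>J - {j}. int (w j l)) - 5"
      using ins[of j "J - {j}"] j JI finJ by (auto simp: insert_absorb)
    moreover have "\<Phi> J \<le> \<Phi> (J - {j})" using JP by (intro J_min) auto
    moreover have "(\<Sum>l\<in>J. w j l) = (\<Sum>l\<in>J - {j}. w j l)"
      using j JI finJ irrefl by (auto simp: sum.remove)
    ultimately have "2 * int (\<Sum>l\<in>J. w j l) \<le> 5" by simp
    thus ?thesis by linarith
  qed
  have outside: "3 \<le> (\<Sum>l\<in>J. w i l)" if i: "i \<in> P" "i \<notin> J" for i
  proof -
    have "\<Phi> J \<le> \<Phi> (insert i J)" using JP i by (intro J_min) auto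
    hence "5 \<le> 2 * int (\<Sum>l\<in>J. w i l)" using ins[of i J] i finJ by (auto simp: P_def)
    thus ?thesis by linarith
  qed
  have weight: "3 * p i \<le> (\<Sum>j\<in>J. M j i) * p i" if i: "i \<in> I" for i
  proof (cases "i \<in> P")
    case True
    have "(\<Sum>j\<in>J. M j i) = real (\<Sum>j\<in>J. w i j) + (if i \<in> J then 3 else 0)"
      using finJ sym by (simp add: M_def sum.distrib)
    moreover have "i \<in> J \<or> 3 \<le> real (\<Sum>j\<in>J. w i j)"
      using outside[OF True] by linarith
    ultimately have "3 \<le> (\<Sum>j\<in>J. M j i)" by (auto simp del: of_nat_sum)
    thus ?thesis using p0[OF i] by (intro mult_right_mono) auto
  next
    case False
    thus ?thesis using i p0[OF i] by (auto simp: P_def)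
  qed
  have "3 = (\<Sum>i\<in>I. 3 * p i)" using psum by (simp add: sum_distrib_left[symmetric])
  also have "\<dots> \<le> (\<Sum>i\<in>I. (\<Sum>j\<in>J. M j i) * p i)" using weight by (rule sum_mono)
  also have "\<dots> = (\<Sum>j\<in>J. \<Sum>i\<in>I. M j i * p i)"
    by (simp add: sum_distrib_right sum.swap[of _ J I])
  also have "\<dots> \<le> (\<Sum>j\<in>J. \<Lambda>)" using crit JP by (intro sum_mono) (auto simp: P_def)
  finally have "3 \<le> real (card J) * \<Lambda>" by simp
  moreover have "(\<Sum>i\<in>I. \<Sum>j\<in>I. M i j) = 3 * real (card I) + real (\<Sum>i\<in>I. \<Sum>j\<in>I. w i j)"
    using I by (simp add: M_def sum.distrib)
  moreover have "real (card I) > 0" using I by (simp add: card_gt_0_iff)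
  ultimately have "3 * (real (card I))\<^sup>2
      \<le> real (card J) * (3 * real (card I) + real (\<Sum>i\<in>I. \<Sum>j\<in>I. w i j))"
    by (simp add: \<Lambda>_def field_simps)
  hence "real (3 * (card I)\<^sup>2) \<le> real (card J * (3 * card I + (\<Sum>i\<in>I. \<Sum>j\<in>I. w i j)))"
    by simp
  hence "3 * (card I)\<^sup>2 \<le> card J * (3 * card I + (\<Sum>i\<in>I. \<Sum>j\<in>I. w i j))"
    by (simp only: of_nat_le_iff)
  thus thesis using that JI inside by blast
qed

section \<open>Attained extrema on the cube, and certificates of minimal blocks\<close>

lemma finite_cube [simp]: "finite (cube n)"
proof -
  have "cube n \<subseteq> (\<lambda>A i. i \<in> A) ` Pow {..<n}"
  proof
    fix x assume "x \<in> cube n"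
    hence "{i. x i} \<in> Pow {..<n}" by (auto simp: cube_def not_le[symmetric])
    thus "x \<in> (\<lambda>A i. i \<in> A) ` Pow {..<n}" by (intro image_eqI[of _ _ "{i. x i}"]) auto
  qed
  thus ?thesis by (rule finite_subset) simp
qed

lemma flip_empty [simp]: "flip x {} = x"
  by (simp add: flip_def)

lemma flip_flip: "flip (flip x A) B = flip x (sym_diff A B)"
  by (auto simp: flip_def)

lemma flip_in_cube: "x \<in> cube n \<Longrightarrow> A \<subseteq> {..<n} \<Longrightarrow> flip x A \<in> cube n"
  by (auto simp: flip_def cube_def)

lemma sens_le_s0: "x \<in> cube n \<Longrightarrow> \<not> f x \<Longrightarrow> sens n f x \<le> s0 n f"
  unfolding s0_def by (intro Max_ge finite_imageI) auto

lemma cert_le_C1: "x \<in> cube n \<Longrightarrow> f x \<Longrightarrow> cert n f x \<le> C1 n f"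
  unfolding C1_def by (intro Max_ge finite_imageI) auto

lemma cert_attained:
  assumes x: "x \<in> cube n"
  obtains S where "is_cert n f x S" "card S = cert n f x"
proof -
  have "is_cert n f x {..<n}"
  proof -
    have "y = x" if "y \<in> cube n" "\<forall>i\<in>{..<n}. y i = x i" for y
    proof
      fix i show "y i = x i" using that x by (cases "i < n") (auto simp: cube_def)
    qed
    thus ?thesis unfolding is_cert_def by blast
  qed
  moreover have "finite {S. is_cert n f x S}"
    by (rule finite_subset[of _ "Pow {..<n}"]) (auto simp: is_cert_def)
  ultimately have "cert n f x \<in> card ` {S. is_cert n f x S}"
    unfolding cert_def by (intro Min_in) auto
  thus thesis using that by auto
qed

lemma bsens_attained:
  obtains B where "\<And>j. j < bsens n f x \<Longrightarrow> B j \<subseteq> {..<n} \<and> f (flip x (B j)) \<noteq> f x"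
    "\<And>j k. j < bsens n f x \<Longrightarrow> k < bsens n f x \<Longrightarrow> j \<noteq> k \<Longrightarrow> B j \<inter> B k = {}"
proof -
  define P where "P b B \<longleftrightarrow> (\<forall>j<b. B j \<subseteq> {..<n} \<and> f (flip x (B j)) \<noteq> f x)
      \<and> (\<forall>j<b. \<forall>k<b. j \<noteq> k \<longrightarrow> B j \<inter> B k = {})" for b and B :: "nat \<Rightarrow> nat set"
  have "b \<le> n" if "P b B" for b B
  proof -
    have sub: "B j \<subseteq> {..<n}" and neq: "f (flip x (B j)) \<noteq> f x" if "j < b" for j
      using \<open>P b B\<close> that by (simp_all add: P_def)
    have dis: "B j \<inter> B k = {}" if "j < b" "k < b" "j \<noteq> k" for j k
      using \<open>P b B\<close> that by (simp add: P_def)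
    \<comment> \<open>Sensitive blocks are nonempty, so disjoint ones have distinct representatives
      in [n]. This bounds their number and makes the \<open>Max\<close> in \<open>bsens\<close> an
      attained value.\<close>
    define a where "a j = (SOME i. i \<in> B j)" for j
    have a: "a j \<in> B j" if "j < b" for j
      unfolding a_def some_in_eq using neq[OF that] flip_empty[of x] by metis
    have "inj_on a {..<b}"
    proof (rule inj_onI)
      fix j k assume jk: "j \<in> {..<b}" "k \<in> {..<b}" "a j = a k"
      hence "a j \<in> B j \<inter> B k" using a[of j] a[of k] by simp
      thus "j = k" using dis[of j k] jk by auto
    qed
    moreover have "a ` {..<b} \<subseteq> {..<n}" using a sub by fast
    ultimately have "card {..<b} \<le> card {..<n}" by (rule card_inj_on_le) simp
    thus ?thesis by simp
  qed
  hence "{b. \<exists>B. P b B} \<subseteq> {..n}" by auto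
  hence "finite {b. \<exists>B. P b B}" by (rule finite_subset) simp
  moreover have "{b. \<exists>B. P b B} \<noteq> {}"
  proof -
    have "P 0 (\<lambda>_. {})" by (simp add: P_def)
    thus ?thesis by blast
  qed
  ultimately have "bsens n f x \<in> {b. \<exists>B. P b B}"
    unfolding bsens_def P_def[symmetric] by (rule Max_in)
  then obtain B where "P (bsens n f x) B" by blast
  thus thesis by (intro that[of B]) (simp_all add: P_def)
qed

lemma bs0_attained:
  assumes "x \<in> cube n" "\<not> f x"
  obtains z where "z \<in> cube n" "\<not> f z" "bsens n f z = bs0 n f"
proof -
  have "bs0 n f \<in> bsens n f ` {x \<in> cube n. f x = False}"
    unfolding bs0_def using assms
    by (intro Max_in finite_imageI) auto
  thus thesis using that by auto
qed

text \<open>Take \<open>B\<close> minimal and a shortest certificate domain \<open>S\<close> of the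
  flipped input. An element of \<open>B\<close> outside \<open>S\<close> could be unflipped without
  leaving the certificate, against minimality; so \<open>B\<close> lies in \<open>S\<close>, and
  \<open>Z\<close> is \<open>S - B\<close>. It is shorter than \<open>S\<close> because
  \<open>B\<close> is nonempty.\<close>

lemma minimal_block_certificate:
  assumes x: "x \<in> cube n" "\<not> f x" and A: "A \<subseteq> {..<n}" "f (flip x A)"
  obtains B Z where "B \<subseteq> A" "B \<inter> Z = {}" "finite Z" "card Z + 1 \<le> C1 n f"
    "\<And>X. X \<subseteq> {..<n} \<Longrightarrow> B \<subseteq> X \<Longrightarrow> X \<inter> Z = {} \<Longrightarrow> f (flip x X)"
proof -
  define \<B> where "\<B> = {B. B \<subseteq> A \<and> f (flip x B)}"
  have "finite \<B>"
    using A(1) by (intro finite_subset[of \<B> "Pow {..<n}"]) (auto simp: \<B>_def)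
  moreover have "A \<in> \<B>" using A(2) by (simp add: \<B>_def)
  ultimately obtain B where B: "B \<in> \<B>" "\<forall>B'\<in>\<B>. B' \<subseteq> B \<longrightarrow> B = B'"
    using finite_has_minimal2[of \<B> A] by blast
  have BA: "B \<subseteq> A" and fB: "f (flip x B)" using B(1) by (auto simp: \<B>_def)
  have min: "B = B'" if "B' \<subseteq> B" "f (flip x B')" for B'
    using B(2) that BA by (auto simp: \<B>_def)
  have Bn: "B \<subseteq> {..<n}" using BA A by blast
  define y where "y = flip x B"
  have y: "y \<in> cube n" "f y" using flip_in_cube[OF x(1) Bn] fB by (auto simp: y_def)
  obtain S where S: "is_cert n f y S" "card S = cert n f y" using cert_attained[OF y(1)] by blast
  have finS: "finite S" using S(1) finite_subset by (auto simp: is_cert_def)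
  have agree: "f (flip x X)" if "X \<subseteq> {..<n}" "\<And>i. i \<in> S \<Longrightarrow> i \<in> X \<longleftrightarrow> i \<in> B" for X
  proof -
    have "\<forall>i\<in>S. flip x X i = y i" using that(2) by (auto simp: y_def flip_def)
    moreover have "f z = f y" if "z \<in> cube n" "\<forall>i\<in>S. z i = y i" for z
      using S(1) y(1) that unfolding is_cert_def by blast
    ultimately have "f (flip x X) = f y" using flip_in_cube[OF x(1) that(1)] by blast
    thus ?thesis using y by simp
  qed
  have BS: "B \<subseteq> S"
  proof
    fix b assume b: "b \<in> B"
    show "b \<in> S"
    proof (rule ccontr)
      assume "b \<notin> S"
      hence "f (flip x (B - {b}))" by (intro agree[of "B - {b}"]) (use Bn in auto)
      thus False using min[of "B - {b}"] b by blast
    qed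
  qed
  show thesis
  proof (rule that)
    have "B \<noteq> {}" using fB x by auto
    hence "card (S - B) < card S" using BS finS by (intro psubset_card_mono) auto
    also have "card S \<le> C1 n f" using cert_le_C1[of y n f] y S(2) by simp
    finally show "card (S - B) + 1 \<le> C1 n f" by simp
    show "f (flip x X)" if "X \<subseteq> {..<n}" "B \<subseteq> X" "X \<inter> (S - B) = {}" for X
      using agree[OF that(1)] that(2,3) by blast
  qed (use BA finS in auto)
qed

section \<open>The bound from sparse block sets and sensitive 0-inputs\<close>

theorem theorem3:
  fixes n :: nat and f :: "(nat \<Rightarrow> bool) \<Rightarrow> bool"
  assumes nonconst: "\<exists>x\<in>cube n. \<exists>y\<in>cube n. f x \<noteq> f y"
  shows "real (C1 n f) \<ge> 3 / 2 * (real (bs0 n f) / real (s0 n f)) - 1 / 2"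
proof (cases "bs0 n f = 0")
  case False
  define k where "k = bs0 n f"
  obtain x0 where "x0 \<in> cube n" "\<not> f x0" using nonconst by auto
  then obtain x where x: "x \<in> cube n" "\<not> f x" and kx: "bsens n f x = k"
    unfolding k_def by (rule bs0_attained)
  obtain A where "\<And>j. j < k \<Longrightarrow> A j \<subseteq> {..<n} \<and> f (flip x (A j)) \<noteq> f x"
    and A_disj: "\<And>i j. i < k \<Longrightarrow> j < k \<Longrightarrow> i \<noteq> j \<Longrightarrow> A i \<inter> A j = {}"
    using bsens_attained[of n f x] unfolding kx by blast
  hence A: "A j \<subseteq> {..<n}" "f (flip x (A j))" if "j < k" for j
    using that x(2) by simp_all
  define P where "P j B Z \<longleftrightarrow> B \<subseteq> A j \<and> B \<inter> Z = {} \<and> finite Z \<and> card Z + 1 \<le> C1 n f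
      \<and> (\<forall>X. X \<subseteq> {..<n} \<longrightarrow> B \<subseteq> X \<longrightarrow> X \<inter> Z = {} \<longrightarrow> f (flip x X))" for j B Z
  have "\<exists>B Z. P j B Z" if "j < k" for j
    by (rule minimal_block_certificate[OF x A[OF that]]) (auto simp: P_def)
  then obtain B Z where P: "\<And>j. j < k \<Longrightarrow> P j (B j) (Z j)" by metis
  have BA: "B j \<subseteq> A j" and BZ: "B j \<inter> Z j = {}" and finZ: "finite (Z j)"
    and Z_card: "card (Z j) + 1 \<le> C1 n f"
    and cert: "\<And>X. X \<subseteq> {..<n} \<Longrightarrow> B j \<subseteq> X \<Longrightarrow> X \<inter> Z j = {} \<Longrightarrow> f (flip x X)"
    if "j < k" for j
    using P[OF that] unfolding P_def by blast+
  have Bn: "B j \<subseteq> {..<n}" if "j < k" for j using BA A that by blast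
  have finB: "finite (B j)" if "j < k" for j using Bn[OF that] finite_subset by blast
  have disj: "B i \<inter> B j = {}" if "i < k" "j < k" "i \<noteq> j" for i j
    using BA that A_disj[OF that] by blast
  define w where "w i j = card (Z i \<inter> B j) + card (Z j \<inter> B i)" for i j
  obtain J where J: "J \<subseteq> {..<k}" "\<And>j. j \<in> J \<Longrightarrow> (\<Sum>l\<in>J. w j l) \<le> 2"
    and J_card: "3 * k\<^sup>2 \<le> card J * (3 * k + (\<Sum>i<k. \<Sum>j<k. w i j))"
    using sparse_subset[of "{..<k}" w] False BZ by (auto simp: w_def k_def Int_commute add.commute)
  have out: "(\<Sum>j<k. card (Z i \<inter> B j)) \<le> C1 n f - 1" if i: "i < k" for i
  proof -
    \<comment> \<open>Disjoint blocks meet \<open>Z i\<close> in disjoint sets.\<close>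
    have "(\<Sum>j<k. card (Z i \<inter> B j)) = card (\<Union>j<k. Z i \<inter> B j)"
      using finZ[OF i] disj by (intro card_UN_disjoint[symmetric]) auto
    also have "\<dots> \<le> card (Z i)" using finZ[OF i] by (intro card_mono) auto
    finally show ?thesis using Z_card[OF i] by simp
  qed
  \<comment> \<open>Each conflict is counted in both \<open>w i j\<close> and \<open>w j i\<close>,
    hence the factor 2.\<close>
  have total: "(\<Sum>i<k. \<Sum>j<k. w i j) \<le> 2 * (k * (C1 n f - 1))"
  proof -
    have "(\<Sum>i<k. \<Sum>j<k. card (Z i \<inter> B j)) \<le> (\<Sum>i<k. C1 n f - 1)" using out by (intro sum_mono) auto
    moreover have "(\<Sum>i<k. \<Sum>j<k. card (Z j \<inter> B i)) = (\<Sum>i<k. \<Sum>j<k. card (Z i \<inter> B j))"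
      by (rule sum.swap)
    ultimately show ?thesis by (simp add: w_def sum.distrib)
  qed
  \<comment> \<open>The set function is \<open>f (flip x X)\<close>; sensitive elements of the
    blocks then count towards the sensitivity of \<open>flip x X\<close>.\<close>
  have "\<exists>X\<subseteq>\<Union> (B ` J). \<not> f (flip x X)
      \<and> card J \<le> card {a \<in> \<Union> (B ` J). f (flip x (sym_diff X {a}))}"
  proof (rule sensitive_zero)
    show "finite J" using J(1) finite_subset by blast
    show "f (flip x X)" if "i \<in> J" "X \<subseteq> \<Union> (B ` J)" "B i \<subseteq> X" "X \<inter> Z i = {}" for i X
      using cert[of i X] that J(1) Bn by blast
    show "(\<Sum>j\<in>J. card (Z i \<inter> B j) + card (Z j \<inter> B i)) \<le> 2" if "i \<in> J" for i
      using J(2)[OF that] by (simp add: w_def)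
    show "finite (B i)" "B i \<inter> Z i = {}" if "i \<in> J" for i
      using finB BZ that J(1) by blast+
    show "B i \<inter> B j = {}" if "i \<in> J" "j \<in> J" "i \<noteq> j" for i j
      using disj[of i j] that J(1) by blast
  qed (simp add: x(2))
  then obtain X where X: "X \<subseteq> \<Union> (B ` J)" "\<not> f (flip x X)"
    and X_card: "card J \<le> card {a \<in> \<Union> (B ` J). f (flip x (sym_diff X {a}))}" by blast
  have Un: "\<Union> (B ` J) \<subseteq> {..<n}" using J(1) Bn by blast
  have "card {a \<in> \<Union> (B ` J). f (flip x (sym_diff X {a}))} \<le> sens n f (flip x X)"
    unfolding sens_def using Un X(2) by (intro card_mono) (auto simp: flip_flip)
  also have "\<dots> \<le> s0 n f"
    using X Un by (intro sens_le_s0 flip_in_cube[OF x(1)]) auto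
  finally have Js: "card J \<le> s0 n f" using X_card by simp
  \<comment> \<open>This makes the natural-number difference \<open>C1 n f - 1\<close> a true one,
    so that 3 + 2 (C_1 - 1) is 2 C_1 + 1.\<close>
  have C: "C1 n f \<ge> 1" using Z_card[of 0] False by (simp add: k_def)
  have "3 * k * k \<le> s0 n f * (3 * k + 2 * (k * (C1 n f - 1)))"
    using J_card mult_mono[OF Js add_left_mono[OF total, of "3 * k"]]
    by (simp add: power2_eq_square mult.assoc)
  also have "\<dots> = s0 n f * (2 * C1 n f + 1) * k" using C by (simp add: algebra_simps diff_mult_distrib2)
  finally have "3 * k \<le> s0 n f * (2 * C1 n f + 1)" using False by (simp add: k_def)
  hence "real (3 * k) \<le> real (s0 n f * (2 * C1 n f + 1))" by (simp only: of_nat_le_iff)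
  \<comment> \<open>For \<open>s0 n f = 0\<close> the quotient is 0 by convention.\<close>
  thus ?thesis by (cases "s0 n f = 0") (simp_all add: k_def field_simps)
qed simp

end
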